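(* For all integers $m\ge1$ and $k\ge1$, $$I_{1^-}^m\left[(1-x)^{k-1}\log\Gamma(x)\right](0)=\int_{0}^{1}\int_{t_1}^{1}\cdots\int_{t_{m-1}}^{1}(1-t_m)^{k-1}\log\Gamma(t_m)\,dt_m\cdots dt_2\,dt_1=\sum_{n=0}^{k-1}(-1)^n(m+n-1)\cdots m\,\binom{k-1}{n}\,I_{1^-}^{n+m}\log\Gamma(0),$$ where the empty product $(m+n-1)\cdots m$ when $n=0$ is taken to be $1$.
   Context: $\Gamma$ is Euler's gamma function and $\log\Gamma(t)$ is the real logarithm for $t\in(0,1]$. For $\mathfrak{Re}(\alpha)>0$ the right-sided Riemann-Liouville fractional integral of order $\alpha$ of $f$ on $[a,b]$ is $I_{b^-}^\alpha f(x)=\frac{1}{\Gamma(\alpha)}\int_x^b (t-x)^{\alpha-1}f(t)\,dt$ ($a\le x<b$). Here $a=0$, $b=1$, so for an integer $j\ge1$, $I_{1^-}^j[f(x)](0)=\frac{1}{(j-1)!}\int_0^1 t^{j-1}f(t)\,dt$ and $I_{1^-}^{j}\log\Gamma(0)=\frac{1}{(j-1)!}\int_0^1 t^{j-1}\log\Gamma(t)\,dt$. The product $(m+n-1)\cdots m$ is $\frac{(m+n-1)!}{(m-1)!}$. For $m=1$ the repeated integral is $\int_0^1 (1-t_1)^{k-1}\log\Gamma(t_1)\,dt_1$. *)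

theory Defs
  imports "HOL-Analysis.Analysis"
begin

text \<open>
  Right-sided Riemann--Liouville fractional integral \<open>I\<^sub>b\<^sub>-\<^sup>\<alpha> f(x)\<close>, meant for
  \<open>0 < Re \<alpha>\<close> and \<open>x < b\<close>.  The left end point \<open>a\<close> of the interval only restricts the
  domain of \<open>x\<close> and is not a parameter.  The values at the end points of the (Lebesgue)
  integral, where \<open>0 powr _ = 0\<close>, are immaterial.
\<close>

definition RL_right :: "real \<Rightarrow> complex \<Rightarrow> (real \<Rightarrow> complex) \<Rightarrow> real \<Rightarrow> complex" where
  "RL_right b \<alpha> f x =
     1 / Gamma \<alpha> * (LINT t:{x..b}|lborel. complex_of_real (t - x) powr (\<alpha> - 1) * f t)"

text \<open>
  \<open>iter_integral b m f x\<close> is the \<open>m\<close>-fold integral of \<open>f(t\<^sub>m)\<close>, where \<open>t\<^sub>1\<close> (outermost) runs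
  over \<open>[x, b]\<close> and \<open>t\<^sub>i\<^sub>+\<^sub>1\<close> runs over \<open>[t\<^sub>i, b]\<close>.
\<close>

primrec iter_integral :: "real \<Rightarrow> nat \<Rightarrow> (real \<Rightarrow> real) \<Rightarrow> real \<Rightarrow> real" where
  "iter_integral b 0 f x = f x"
| "iter_integral b (Suc m) f x = (LINT t:{x..b}|lborel. iter_integral b m f t)"

end

theory Submission
  imports Defs "HOL-Real_Asymp.Real_Asymp"
begin

text \<open>
  Both equalities reduce to the single weighted integral
  \<open>(\<integral>\<^sub>0\<^sup>1 t^(m-1) (1-t)^(k-1) ln (Gamma t) dt) / (m-1)!\<close>.
  It is by definition the fractional integral on the left (\<open>RL_right_of_nat\<close>).  The
  repeated integral equals it by Cauchy's formula for repeated integration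
  (\<open>iter_integral_Cauchy\<close>): interchanging two neighbouring integrations over the triangle
  \<open>x \<le> s \<le> t \<le> b\<close> turns the kernel \<open>(t-s)^n\<close> into \<open>(t-x)^(n+1) / (n+1)\<close>.
  The sum on the right arises by expanding \<open>(1-t)^(k-1)\<close> binomially under the integral
  (\<open>weighted_integral_binomial\<close>): the term with \<open>t^(m-1+n)\<close> is a fractional integral of
  order \<open>m+n\<close>, and the quotient \<open>(m+n-1)! / (m-1)!\<close> of the two normalising
  factors is the product \<open>m \<cdots> (m+n-1)\<close>.

  The only property of \<open>ln (Gamma t)\<close> that enters is its absolute integrability on
  \<open>[0,1]\<close> (\<open>set_integrable_ln_Gamma\<close>), which justifies Fubini's theorem and the
  splitting of the integral into finitely many terms.
\<close>

lemma set_integrable_bounded_mult: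
  fixes f p :: "real \<Rightarrow> real"
  assumes f: "set_integrable lborel S f"
    and p: "p \<in> borel_measurable borel"
    and bound: "\<And>t. t \<in> S \<Longrightarrow> \<bar>p t\<bar> \<le> B"
  shows "set_integrable lborel S (\<lambda>t. p t * f t)"
  unfolding set_integrable_def
proof (rule Bochner_Integration.integrable_bound)
  show "integrable lborel (\<lambda>t. B * (indicator S t *\<^sub>R f t))"
    using f unfolding set_integrable_def by (rule integrable_mult_right)
  have "(\<lambda>t. indicator S t *\<^sub>R f t) \<in> borel_measurable lborel"
    using f unfolding set_integrable_def by (rule borel_measurable_integrable)
  then have "(\<lambda>t. p t * (indicator S t *\<^sub>R f t)) \<in> borel_measurable lborel"
    using p by (intro borel_measurable_times) simp_all
  then show "(\<lambda>t. indicator S t *\<^sub>R (p t * f t)) \<in> borel_measurable lborel"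
    by (simp add: mult.left_commute)
  show "AE t in lborel. norm (indicator S t *\<^sub>R (p t * f t)) \<le> norm (B * (indicator S t *\<^sub>R f t))"
  proof (rule AE_I2)
    fix t
    have "\<bar>p t\<bar> * \<bar>f t\<bar> \<le> \<bar>B\<bar> * \<bar>f t\<bar>" if "t \<in> S"
      using bound[OF that] by (intro mult_right_mono) auto
    then show "norm (indicator S t *\<^sub>R (p t * f t)) \<le> norm (B * (indicator S t *\<^sub>R f t))"
      by (cases "t \<in> S") (simp_all add: abs_mult)
  qed
qed

text \<open>
  At the lower end point the complex power \<open>0 powr 0 = 0\<close> disagrees with \<open>0 ^ 0 = 1\<close>,
  so for \<open>n = 0\<close> the two integrands agree only off the null set \<open>{x}\<close>.
\<close>

lemma RL_right_of_nat:
  fixes f :: "real \<Rightarrow> real"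
  shows "RL_right b (of_nat (Suc n)) (\<lambda>t. complex_of_real (f t)) x =
           complex_of_real ((LINT t:{x..b}|lborel. (t - x) ^ n * f t) / fact n)"
proof -
  have "(LINT t:{x..b}|lborel. complex_of_real (t - x) powr (of_nat (Suc n) - 1) * complex_of_real (f t))
      = (LINT t:{x..b}|lborel. complex_of_real ((t - x) ^ n * f t))"
    unfolding set_lebesgue_integral_def
    by (rule integral_discrete_difference[where X = "{x}"]) (simp_all add: powr_nat')
  also have "\<dots> = complex_of_real (LINT t:{x..b}|lborel. (t - x) ^ n * f t)"
    by (rule set_integral_complex_of_real)
  finally show ?thesis
    by (simp add: RL_right_def Gamma_fact)
qed

lemma set_integral_power_diff:
  fixes x t :: real
  assumes "x \<le> t"
  shows "(LINT s:{x..t}|lborel. (t - s) ^ n) = (t - x) ^ Suc n / real (Suc n)"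
proof -
  have "(LINT s:{x..t}|lborel. (t - s) ^ n)
      = (- ((t - t) ^ Suc n / real (Suc n))) - (- ((t - x) ^ Suc n / real (Suc n)))"
    unfolding set_lebesgue_integral_def
  proof (rule integral_FTC_Icc[OF assms])
    show "((\<lambda>s. - ((t - s) ^ Suc n / real (Suc n))) has_vector_derivative (t - s) ^ n)
            (at s within {x..t})" for s
      unfolding has_real_derivative_iff_has_vector_derivative[symmetric]
      by (rule derivative_eq_intros refl | simp)+
  qed (intro continuous_intros)
  then show ?thesis by simp
qed

text \<open>
  Fubini's theorem on the triangle \<open>x \<le> s \<le> t \<le> b\<close>.  For fixed \<open>t\<close> the inner integral
  over \<open>s\<close> no longer involves \<open>f\<close> and is elementary.
\<close>

lemma integral_power_kernel_swap:
  fixes f :: "real \<Rightarrow> real"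
  assumes f: "set_integrable lborel {x..b} f"
  shows "(LINT s:{x..b}|lborel. LINT t:{s..b}|lborel. (t - s) ^ n * f t) =
           (LINT t:{x..b}|lborel. (t - x) ^ Suc n * f t) / real (Suc n)"
proof -
  \<comment> \<open>The hypothesis controls \<open>f\<close> only on \<open>{x..b}\<close>; cutting it off there gives a function
      that is Borel on the whole line.\<close>
  define F where "F t = indicator {x..b} t *\<^sub>R f t" for t
  define h where "h t s = (if x \<le> s \<and> s \<le> t \<and> t \<le> b then (t - s) ^ n * F t else 0)" for t s
  have F: "integrable lborel F"
    using f unfolding set_integrable_def F_def .
  have F_meas [measurable]: "F \<in> borel_measurable borel"
    using borel_measurable_integrable[OF F] by simp
  \<comment> \<open>On the triangle \<open>(t - s) ^ n \<le> (b - x) ^ n\<close>, so up to this constant the product below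
      dominates \<open>h\<close> in absolute value.\<close>
  have dom: "integrable (lborel \<Otimes>\<^sub>M lborel) (\<lambda>(t, s). F t * indicator {x..b} s)"
  proof (rule lborel_pair.Fubini_integrable)
    show "(\<lambda>(t, s). F t * indicator {x..b} s) \<in> borel_measurable (lborel \<Otimes>\<^sub>M lborel)"
      by measurable
    show "integrable lborel (\<lambda>t. LINT s|lborel. norm (case (t, s) of (t, s) \<Rightarrow> F t * indicator {x..b} s))"
      using F by (simp add: abs_mult)
    show "AE t in lborel. integrable lborel (\<lambda>s. case (t, s) of (t, s) \<Rightarrow> F t * indicator {x..b} s)"
      by (simp add: emeasure_lborel_Icc_eq)
  qed
  have h_int: "integrable (lborel \<Otimes>\<^sub>M lborel) (case_prod h)"
  proof (rule Bochner_Integration.integrable_bound)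
    show "integrable (lborel \<Otimes>\<^sub>M lborel) (\<lambda>z. (b - x) ^ n * (case z of (t, s) \<Rightarrow> F t * indicator {x..b} s))"
      using dom by (rule integrable_mult_right)
    show "case_prod h \<in> borel_measurable (lborel \<Otimes>\<^sub>M lborel)"
      unfolding h_def by measurable
    have "\<bar>h t s\<bar> \<le> \<bar>(b - x) ^ n * (F t * indicator {x..b} s)\<bar>" for t s
    proof (cases "x \<le> s \<and> s \<le> t \<and> t \<le> b")
      case True
      then have "(t - s) ^ n \<le> (b - x) ^ n" by (intro power_mono) auto
      with True show ?thesis
        by (simp add: h_def abs_mult mult_right_mono)
    next
      case False
      then have "h t s = 0" unfolding h_def by (rule if_not_P)
      then show ?thesis by simp
    qed
    then show "AE z in lborel \<Otimes>\<^sub>M lborel. norm (case_prod h z)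
        \<le> norm ((b - x) ^ n * (case z of (t, s) \<Rightarrow> F t * indicator {x..b} s))"
      by (intro AE_I2) auto
  qed
  have "(LINT s:{x..b}|lborel. LINT t:{s..b}|lborel. (t - s) ^ n * f t)
      = (LINT s|lborel. LINT t|lborel. h t s)"
    unfolding set_lebesgue_integral_def
  proof (intro Bochner_Integration.integral_cong refl)
    fix s
    show "indicator {x..b} s *\<^sub>R (LINT t|lborel. indicator {s..b} t *\<^sub>R ((t - s) ^ n * f t))
        = (LINT t|lborel. h t s)"
    proof (cases "x \<le> s \<and> s \<le> b")
      case True
      then show ?thesis
        by (auto simp: h_def F_def indicator_def intro!: Bochner_Integration.integral_cong)
    next
      case False
      then have "h t s = 0" for t by (auto simp: h_def)
      with False show ?thesis by (simp add: indicator_def)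
    qed
  qed
  also have "\<dots> = (LINT t|lborel. LINT s|lborel. h t s)"
    by (rule lborel_pair.Fubini_integral[OF h_int])
  also have "\<dots> = (LINT t:{x..b}|lborel. (t - x) ^ Suc n * f t / real (Suc n))"
    unfolding set_lebesgue_integral_def
  proof (intro Bochner_Integration.integral_cong refl)
    fix t
    show "(LINT s|lborel. h t s) = indicator {x..b} t *\<^sub>R ((t - x) ^ Suc n * f t / real (Suc n))"
    proof (cases "x \<le> t \<and> t \<le> b")
      case True
      then have "(LINT s|lborel. h t s) = (LINT s|lborel. (indicator {x..t} s *\<^sub>R (t - s) ^ n) * f t)"
        by (intro Bochner_Integration.integral_cong) (auto simp: h_def F_def indicator_def)
      also have "\<dots> = (LINT s:{x..t}|lborel. (t - s) ^ n) * f t"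
        unfolding set_lebesgue_integral_def by (rule integral_mult_left_zero)
      finally show ?thesis
        using True by (simp add: set_integral_power_diff del: power_Suc of_nat_Suc)
    next
      case False
      then have "h t s = 0" for s by (auto simp: h_def)
      with False show ?thesis by (simp add: indicator_def)
    qed
  qed
  finally show ?thesis by (simp del: power_Suc of_nat_Suc)
qed

text \<open>
  Cauchy's formula for repeated integration.  The induction peels off the outermost integral,
  so the lower end point has to vary: the induction hypothesis is applied at every
  \<open>s\<close> between \<open>x\<close> and \<open>b\<close>.
\<close>

lemma iter_integral_Cauchy:
  fixes f :: "real \<Rightarrow> real"
  assumes "set_integrable lborel {x..b} f"
  shows "iter_integral b (Suc n) f x = (LINT t:{x..b}|lborel. (t - x) ^ n * f t) / fact n"
  using assms
proof (induction n arbitrary: x)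
  case (Suc n)
  have "iter_integral b (Suc (Suc n)) f x = (LINT s:{x..b}|lborel. iter_integral b (Suc n) f s)"
    by simp
  also have "\<dots> = (LINT s:{x..b}|lborel. (LINT t:{s..b}|lborel. (t - s) ^ n * f t) / fact n)"
  proof (intro set_lebesgue_integral_cong allI impI)
    fix s assume "s \<in> {x..b}"
    then show "iter_integral b (Suc n) f s = (LINT t:{s..b}|lborel. (t - s) ^ n * f t) / fact n"
      by (intro Suc.IH set_integrable_subset[OF Suc.prems]) auto
  qed simp
  also have "\<dots> = (LINT t:{x..b}|lborel. (t - x) ^ Suc n * f t) / fact (Suc n)"
    by (simp add: integral_power_kernel_swap[OF Suc.prems] del: power_Suc of_nat_Suc)
  finally show ?case .
qed simp

text \<open>
  The functional equation gives \<open>ln (Gamma t) = ln (Gamma (t + 1)) - ln t\<close>, in which the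
  first term is continuous on \<open>[0,1]\<close>.  The singularity at 0 is thus that of \<open>- ln t\<close>,
  which is nonnegative on \<open>(0,1)\<close> and whose antiderivative \<open>t - t ln t\<close> has finite limits
  at both ends.
\<close>

lemma set_integrable_ln_Gamma: "set_integrable lborel {0..1} (\<lambda>t::real. ln (Gamma t))"
proof -
  have "set_integrable lborel (einterval (ereal 0) (ereal 1)) (\<lambda>t. - ln t)"
  proof (rule interval_integral_FTC_nonneg)
    show "((\<lambda>t. t - t * ln t) has_real_derivative - ln t) (at t)" if "ereal 0 < ereal t" for t
      using that by (auto intro!: derivative_eq_intros)
    show "(((\<lambda>t. t - t * ln t) \<circ> real_of_ereal) \<longlongrightarrow> 0) (at_right (ereal 0))"
    proof -
      have "((\<lambda>t::real. t - t * ln t) \<longlongrightarrow> 0) (at_right 0)" by real_asymp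
      then show ?thesis by (simp add: ereal_tendsto_simps)
    qed
    show "(((\<lambda>t. t - t * ln t) \<circ> real_of_ereal) \<longlongrightarrow> 1) (at_left (ereal 1))"
    proof -
      have "((\<lambda>t::real. t - t * ln t) \<longlongrightarrow> 1) (at_left 1)" by real_asymp
      then show ?thesis by (simp add: ereal_tendsto_simps)
    qed
  qed (auto intro!: continuous_intros)
  then have neg_ln: "set_integrable lborel {0<..<1} (\<lambda>t::real. - ln t)"
    by simp
  have "continuous_on {0..1} (\<lambda>t::real. ln (Gamma (t + 1)))"
  proof (intro continuous_on_ln continuous_on_compose2[OF continuous_on_Gamma[of "{0<..}"]] ballI)
    show "Gamma (t + 1) \<noteq> 0" if "t \<in> {0..1}" for t :: real
      by (rule less_imp_neq[symmetric], rule Gamma_real_pos) (use that in simp)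
  qed (auto intro!: continuous_intros elim!: nonpos_Ints_cases)
  then have "set_integrable lborel {0..1} (\<lambda>t::real. ln (Gamma (t + 1)))"
    by (rule borel_integrable_atLeastAtMost')
  then have "set_integrable lborel {0<..<1} (\<lambda>t::real. ln (Gamma (t + 1)))"
    by (rule set_integrable_subset) auto
  from set_integral_add(1)[OF this neg_ln]
  have sum: "set_integrable lborel {0<..<1} (\<lambda>t::real. ln (Gamma (t + 1)) + - ln t)" .
  have "ln (Gamma (t + 1)) + - ln t = ln (Gamma t)" if "t \<in> {0<..<1}" for t :: real
  proof -
    have "Gamma (t + 1) = t * Gamma t"
      using that by (intro Gamma_plus1) auto
    moreover have "Gamma t \<noteq> 0"
      by (rule less_imp_neq[symmetric], rule Gamma_real_pos) (use that in simp)
    ultimately show ?thesis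
      using that by (simp add: ln_mult)
  qed
  with sum have "set_integrable lborel {0<..<1} (\<lambda>t::real. ln (Gamma t))"
    by (subst set_integrable_cong[OF refl refl, where f' = "\<lambda>t. ln (Gamma (t + 1)) + - ln t"]) auto
  then show ?thesis
    unfolding set_integrable_def
    by (subst integrable_discrete_difference[where X = "{0, 1}"
          and g = "\<lambda>t. indicator {0<..<1} t *\<^sub>R ln (Gamma t)"]) (auto simp: indicator_def)
qed

lemma prod_atLeastLessThan_conv_fact:
  "(\<Prod>i = Suc m..<Suc m + n. of_nat i) = (fact (m + n) / fact m :: 'a :: field_char_0)"
  by (induction n) (simp_all add: field_simps del: of_nat_Suc flip: of_nat_add)

text \<open>
  The division by \<open>fact (m + n)\<close> on the right puts each term into the normalisation of the
  fractional integral of order \<open>m + n + 1\<close>; the rising product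
  \<open>(m + 1) \<cdots> (m + n) = (m + n)! / m!\<close> compensates for it.
\<close>

lemma weighted_integral_binomial:
  fixes f :: "real \<Rightarrow> real"
  assumes f: "set_integrable lborel {0..1} f"
  shows "(LINT t:{0..1}|lborel. t ^ m * ((1 - t) ^ N * f t)) / fact m =
           (\<Sum>n = 0..N. (- 1) ^ n * (\<Prod>i = Suc m..<Suc m + n. of_nat i) * of_nat (N choose n) *
              ((LINT t:{0..1}|lborel. t ^ (m + n) * f t) / fact (m + n)))"
proof -
  have "t ^ m * ((1 - t) ^ N * f t)
      = (\<Sum>n = 0..N. ((- 1) ^ n * of_nat (N choose n)) * (t ^ (m + n) * f t))" for t
  proof -
    have "(1 - t) ^ N = (\<Sum>n = 0..N. of_nat (N choose n) * (- t) ^ n)"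
      using binomial_ring[of "- t" 1 N] by (simp add: atLeast0AtMost)
    then show ?thesis
      by (simp add: sum_distrib_left sum_distrib_right power_add power_minus[of t] mult_ac)
  qed
  then have "(LINT t:{0..1}|lborel. t ^ m * ((1 - t) ^ N * f t))
      = (LINT t:{0..1}|lborel. \<Sum>n = 0..N. ((- 1) ^ n * of_nat (N choose n)) * (t ^ (m + n) * f t))"
    by simp
  also have "\<dots> = (\<Sum>n = 0..N. LINT t:{0..1}|lborel. ((- 1) ^ n * of_nat (N choose n)) * (t ^ (m + n) * f t))"
  proof -
    have "set_integrable lborel {0..1} (\<lambda>t. ((- 1) ^ n * of_nat (N choose n)) * (t ^ (m + n) * f t))" for n
      by (intro set_integrable_mult_right set_integrable_bounded_mult[OF f, where B = 1])
         (auto simp: power_abs intro!: power_le_one)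
    then show ?thesis
      unfolding set_lebesgue_integral_def set_integrable_def scaleR_sum_right
      by (intro Bochner_Integration.integral_sum)
  qed
  also have "\<dots> = (\<Sum>n = 0..N. ((- 1) ^ n * of_nat (N choose n)) * (LINT t:{0..1}|lborel. t ^ (m + n) * f t))"
    by (simp only: set_integral_mult_right)
  finally show ?thesis
    unfolding prod_atLeastLessThan_conv_fact by (simp add: sum_divide_distrib mult.assoc)
qed

theorem corollary4p3:
  fixes m k :: nat
  assumes "m \<ge> 1" and "k \<ge> 1"
  shows "RL_right 1 (of_nat m) (\<lambda>x. complex_of_real ((1 - x) ^ (k - 1) * ln (Gamma x))) 0
           = complex_of_real (iter_integral 1 m (\<lambda>t. (1 - t) ^ (k - 1) * ln (Gamma t)) 0)
       \<and> complex_of_real (iter_integral 1 m (\<lambda>t. (1 - t) ^ (k - 1) * ln (Gamma t)) 0)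
           = (\<Sum>n = 0..k - 1. (- 1) ^ n * (\<Prod>i = m..<m + n. of_nat i) * of_nat ((k - 1) choose n)
                * RL_right 1 (of_nat (n + m)) (\<lambda>x. complex_of_real (ln (Gamma x))) 0)"
proof -
  \<comment> \<open>The kernel of the integral of order \<open>m\<close> has exponent \<open>p = m - 1\<close>.\<close>
  obtain p where m: "m = Suc p"
    using assms(1) by (cases m) auto
  let ?f = "\<lambda>t::real. (1 - t) ^ (k - 1) * ln (Gamma t)"
  have "set_integrable lborel {0..1} ?f"
    by (rule set_integrable_bounded_mult[OF set_integrable_ln_Gamma, where B = 1])
       (auto simp: power_abs intro!: power_le_one)
  then have iter: "iter_integral 1 m ?f 0 = (LINT t:{0..1}|lborel. t ^ p * ?f t) / fact p"
    unfolding m by (subst iter_integral_Cauchy) simp_all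
  have RL: "RL_right 1 (of_nat (n + m)) (\<lambda>x. complex_of_real (g x)) 0
      = complex_of_real ((LINT t:{0..1}|lborel. t ^ (p + n) * g t) / fact (p + n))" for n and g :: "real \<Rightarrow> real"
    using RL_right_of_nat[of 1 "p + n" g 0] by (simp add: m add_ac)
  show ?thesis
  proof (intro conjI)
    show "RL_right 1 (of_nat m) (\<lambda>x. complex_of_real (?f x)) 0 = complex_of_real (iter_integral 1 m ?f 0)"
      unfolding iter using RL[of 0 ?f] by (simp only: add_0 add_0_right)
    show "complex_of_real (iter_integral 1 m ?f 0)
           = (\<Sum>n = 0..k - 1. (- 1) ^ n * (\<Prod>i = m..<m + n. of_nat i) * of_nat ((k - 1) choose n)
                * RL_right 1 (of_nat (n + m)) (\<lambda>x. complex_of_real (ln (Gamma x))) 0)"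
      unfolding iter RL weighted_integral_binomial[OF set_integrable_ln_Gamma]
      by (simp add: m del: prod.op_ivl_Suc of_nat_Suc)
  qed
qed

end
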